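(* Let $S(\lambda)=\int_0^\infty\frac{d\mu(t)}{t-\lambda}$, where $\mu$ is a nontrivial probability measure supported in $[0,+\infty)$, let $\mathfrak J$ be the monic generalized Jacobi matrix associated with $\mathfrak Z(\lambda)=S(\lambda^2)$, and let $\mathfrak J=\mathfrak L\mathfrak U$ be its $LU$-factorization (as specified in the context). Then the matrix $\widetilde{\mathfrak J}=\mathfrak U\mathfrak L$ is the monic classical Jacobi matrix associated with the function $$\widetilde{\mathfrak Z}(\lambda)=\lambda\mathfrak Z(\lambda)+\mathfrak s_0=\lambda\mathfrak Z(\lambda)=\lambda S(\lambda^2),$$ where $\mathfrak s_0=0$ is the coefficient in $\mathfrak Z(\lambda)=-\mathfrak s_0/\lambda+O(\lambda^{-2})$. Besides, the monic orthogonal polynomials $\widetilde{\mathfrak T}_j$ corresponding to $\widetilde{\mathfrak J}$ are $$\widetilde{\mathfrak T}_{2j}(\lambda)=P_j(\lambda^2),\qquad \widetilde{\mathfrak T}_{2j+1}(\lambda)=\lambda\widetilde P_j(\lambda^2)=\frac1\lambda\left(P_{j+1}(\lambda^2)-\frac{P_{j+1}(0)}{P_j(0)}P_j(\lambda^2)\right),\qquad j\in\mathbb Z_+,$$ where $P_j$ and $\widetilde P_j$ are the monic orthogonal polynomials corresponding to the monic Jacobi matrix $J$ of $\mu$ and to its Darboux transformation $\widetilde J$, respectively.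
   Context: $\mathbb Z_+=\{0,1,2,\dots\}$. A nontrivial probability measure has finite moments $s_j=\int t^j\,d\mu$ with $s_0=1$ and $\det(s_{j+k})_{j,k=0}^n>0$ for all $n\in\mathbb Z_+$. Its monic orthogonal polynomials satisfy $\lambda P_j=P_{j+1}+b_jP_j+c_{j-1}P_{j-1}$, $P_{-1}=0$, $P_0=1$, with $b_j\in\mathbb R$, $c_j>0$. A monic (classical) Jacobi matrix is a semi-infinite tridiagonal matrix with real diagonal $\beta_0,\beta_1,\dots$, superdiagonal entries all $1$, and positive subdiagonal $\gamma_0,\gamma_1,\dots$; its corresponding monic polynomials $Q_j$ are given by $\lambda Q_j=Q_{j+1}+\beta_jQ_j+\gamma_{j-1}Q_{j-1}$, $Q_{-1}=0$, $Q_0=1$. It is associated with a function $\Phi$ having an asymptotic expansion $\Phi(\lambda)\sim-\sum_{j\ge0}m_j\lambda^{-j-1}$ (to all orders, $\lambda\to\infty$ in each sector $\varepsilon<\arg\lambda<\pi-\varepsilon$) if the $Q_j$ are the monic orthogonal polynomials for the linear functional $\lambda^j\mapsto m_j$ on polynomials (equivalently, $\beta_j,\gamma_j$ are the coefficients of the $J$-fraction $-\cfrac{1}{\lambda-\beta_0-\cfrac{\gamma_0}{\lambda-\beta_1-\ddots}}$ of $\Phi$). $J$ is the monic Jacobi matrix with diagonal $b_j$ and subdiagonal $c_j$. One has $P_j(0)\neq0$ for all $j$. Put $u_j=-P_{j+1}(0)/P_j(0)>0$, $l_{j+1}=c_j/u_j>0$. Then $J=LU$ with $L$ lower bidiagonal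 with unit diagonal and subdiagonal $l_1,l_2,\dots$, and $U$ upper bidiagonal with diagonal $u_0,u_1,\dots$ and superdiagonal entries all $1$. The Darboux transformation of $J$ is the monic Jacobi matrix $\widetilde J=UL$; its monic polynomials are denoted $\widetilde P_j$. The monic generalized Jacobi matrix associated with $\mathfrak Z(\lambda)=S(\lambda^2)$ is the block tridiagonal matrix $\mathfrak J$ with $2\times2$ blocks: diagonal blocks $\begin{pmatrix}0&1\\ b_j&0\end{pmatrix}$, blocks $\begin{pmatrix}0&0\\1&0\end{pmatrix}$ in position $(j,j+1)$ and $\begin{pmatrix}0&0\\ c_j&0\end{pmatrix}$ in position $(j+1,j)$, $j\in\mathbb Z_+$. Its $LU$-factorization $\mathfrak J=\mathfrak L\mathfrak U$: $\mathfrak L$ is block lower bidiagonal with diagonal blocks $I_2$ and blocks $\mathfrak L_{j}=\begin{pmatrix}0&0\\0&l_{j}\end{pmatrix}$ in position $(j,j-1)$, $j\ge1$; $\mathfrak U$ is block upper bidiagonal with diagonal blocks $\mathfrak U_j=\begin{pmatrix}0&1\\ u_j&0\end{pmatrix}$ and blocks $\mathfrak D_j=\begin{pmatrix}0&0\\1&0\end{pmatrix}$ in position $(j,j+1)$, $j\ge0$. *)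

theory Defs
  imports
    "HOL-Probability.Probability"
    "HOL-Library.Landau_Symbols"
    "HOL-Computational_Algebra.Polynomial"
    "Jordan_Normal_Form.Determinant"
begin

section \<open>Measures\<close>

definition moment :: "real measure \<Rightarrow> nat \<Rightarrow> real" where
  "moment \<mu> j = (LINT t|\<mu>. t ^ j)"

definition hankel :: "(nat \<Rightarrow> real) \<Rightarrow> nat \<Rightarrow> real mat" where
  "hankel s n = Matrix.mat (Suc n) (Suc n) (\<lambda>(j, k). s (j + k))"

definition nontrivial_prob_measure :: "real measure \<Rightarrow> bool" where
  "nontrivial_prob_measure \<mu> \<longleftrightarrow>
     prob_space \<mu> \<and> sets \<mu> = sets borel \<and>
     (\<forall>j. integrable \<mu> (\<lambda>t. t ^ j)) \<and>
     (\<forall>n. Determinant.det (hankel (moment \<mu>) n) > 0)"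

definition stieltjes :: "real measure \<Rightarrow> complex \<Rightarrow> complex" where
  "stieltjes \<mu> z = (LINT t:{0..}|\<mu>. 1 / (complex_of_real t - z))"


section \<open>Orthogonal polynomials\<close>

text \<open>Orthogonality is with respect to a functional that need not be positive, hence the
  condition on the diagonal is non-vanishing.\<close>

definition monic_orthogonal_polys :: "(real poly \<Rightarrow> real) \<Rightarrow> (nat \<Rightarrow> real poly) \<Rightarrow> bool" where
  "monic_orthogonal_polys F Q \<longleftrightarrow>
     (\<forall>j. degree (Q j) = j \<and> lead_coeff (Q j) = 1) \<and>
     (\<forall>j k. j \<noteq> k \<longrightarrow> F (Q j * Q k) = 0) \<and>
     (\<forall>j. F (Q j * Q j) \<noteq> 0)"

definition measure_functional :: "real measure \<Rightarrow> real poly \<Rightarrow> real" where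
  "measure_functional \<mu> p = (LINT t|\<mu>. poly p t)"

definition moment_functional :: "(nat \<Rightarrow> real) \<Rightarrow> real poly \<Rightarrow> real" where
  "moment_functional m p = (\<Sum>i\<le>degree p. Polynomial.coeff p i * m i)"

definition cpoly :: "real poly \<Rightarrow> complex \<Rightarrow> complex" where
  "cpoly p z = poly (map_poly complex_of_real p) z"


section \<open>Semi-infinite matrices\<close>

type_synonym smat = "nat \<Rightarrow> nat \<Rightarrow> real"

text \<open>In all products below the left factor has finitely many nonzero entries in each row,
  so the series is a finite sum.\<close>

definition smat_mult :: "smat \<Rightarrow> smat \<Rightarrow> smat" (infixl \<open>\<odot>\<close> 70) where
  "(A \<odot> B) i k = (\<Sum>j. A i j * B j k)"

definition jacobi_matrix :: "(nat \<Rightarrow> real) \<Rightarrow> (nat \<Rightarrow> real) \<Rightarrow> smat" where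
  "jacobi_matrix \<beta> \<gamma> i k =
     (if k = i then \<beta> i else if k = Suc i then 1 else if i = Suc k then \<gamma> k else 0)"

definition is_monic_jacobi :: "smat \<Rightarrow> bool" where
  "is_monic_jacobi A \<longleftrightarrow> (\<exists>\<beta> \<gamma>. (\<forall>j. \<gamma> j > 0) \<and> A = jacobi_matrix \<beta> \<gamma>)"

fun monic_polys :: "smat \<Rightarrow> nat \<Rightarrow> real poly" where
  "monic_polys A 0 = 1"
| "monic_polys A (Suc 0) = [:- A 0 0, 1:]"
| "monic_polys A (Suc (Suc j)) =
     [:- A (Suc j) (Suc j), 1:] * monic_polys A (Suc j) - Polynomial.smult (A (Suc j) j) (monic_polys A j)"

definition lower_bidiag :: "(nat \<Rightarrow> real) \<Rightarrow> smat" where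
  "lower_bidiag l i k = (if k = i then 1 else if i = Suc k then l i else 0)"

definition upper_bidiag :: "(nat \<Rightarrow> real) \<Rightarrow> smat" where
  "upper_bidiag u i k = (if k = i then u i else if k = Suc i then 1 else 0)"

definition darboux_u :: "(nat \<Rightarrow> real poly) \<Rightarrow> nat \<Rightarrow> real" where
  "darboux_u P j = - poly (P (Suc j)) 0 / poly (P j) 0"

text \<open>The sequence \<open>l\<close> starts at index 1; its value at index 0 never enters a matrix.\<close>

definition darboux_l :: "(nat \<Rightarrow> real poly) \<Rightarrow> (nat \<Rightarrow> real) \<Rightarrow> nat \<Rightarrow> real" where
  "darboux_l P c j = (if j = 0 then 0 else c (j - 1) / darboux_u P (j - 1))"

lemma jacobi_LU_factorization:
  assumes rec: "\<And>j. [:0, 1:] * P j = P (Suc j) + Polynomial.smult (b j) (P j) +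
                  (if j = 0 then 0 else Polynomial.smult (c (j - 1)) (P (j - 1)))"
    and nz: "\<And>j. poly (P j) 0 \<noteq> 0"
  shows "jacobi_matrix b c = lower_bidiag (darboux_l P c) \<odot> upper_bidiag (darboux_u P)"
proof (intro ext)
  fix i k
  let ?L = "lower_bidiag (darboux_l P c)" and ?U = "upper_bidiag (darboux_u P)"
  have at0: "0 = poly (P (Suc j)) 0 + b j * poly (P j) 0 +
      (if j = 0 then 0 else c (j - 1) * poly (P (j - 1)) 0)" for j
    using arg_cong[OF rec[of j], of "\<lambda>p. poly p 0"] by (simp split: if_splits)
  have "(?L \<odot> ?U) i k = (\<Sum>j\<in>{i - 1, i}. ?L i j * ?U j k)"
    unfolding smat_mult_def by (rule suminf_finite) (auto simp: lower_bidiag_def)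
  also have "\<dots> = jacobi_matrix b c i k"
  proof (cases i)
    case 0
    then show ?thesis using at0[of 0] nz
      by (auto simp: lower_bidiag_def upper_bidiag_def jacobi_matrix_def darboux_u_def field_simps)
  next
    case (Suc n)
    then show ?thesis using at0[of i] nz[of n] nz[of i] nz[of "Suc i"]
      by (auto simp: lower_bidiag_def upper_bidiag_def jacobi_matrix_def darboux_u_def
            darboux_l_def field_simps)
  qed
  finally show "jacobi_matrix b c i k = (?L \<odot> ?U) i k" by simp
qed

definition darboux :: "(nat \<Rightarrow> real poly) \<Rightarrow> (nat \<Rightarrow> real) \<Rightarrow> smat" where
  "darboux P c = upper_bidiag (darboux_u P) \<odot> lower_bidiag (darboux_l P c)"


section \<open>Block matrices with \<open>2 \<times> 2\<close> blocks\<close>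

definition block :: "real \<Rightarrow> real \<Rightarrow> real \<Rightarrow> real \<Rightarrow> real mat" where
  "block p q r s = mat_of_rows_list 2 [[p, q], [r, s]]"

definition of_blocks :: "(nat \<Rightarrow> nat \<Rightarrow> real mat) \<Rightarrow> smat" where
  "of_blocks B i k = B (i div 2) (k div 2) $$ (i mod 2, k mod 2)"

definition gen_jacobi :: "(nat \<Rightarrow> real) \<Rightarrow> (nat \<Rightarrow> real) \<Rightarrow> smat" where
  "gen_jacobi b c = of_blocks (\<lambda>i k.
     if k = i then block 0 1 (b i) 0
     else if k = Suc i then block 0 0 1 0
     else if i = Suc k then block 0 0 (c k) 0
     else block 0 0 0 0)"

definition gen_lower :: "(nat \<Rightarrow> real) \<Rightarrow> smat" where
  "gen_lower l = of_blocks (\<lambda>i k.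
     if k = i then block 1 0 0 1
     else if i = Suc k then block 0 0 0 (l i)
     else block 0 0 0 0)"

definition gen_upper :: "(nat \<Rightarrow> real) \<Rightarrow> smat" where
  "gen_upper u = of_blocks (\<lambda>i k.
     if k = i then block 0 1 (u i) 0
     else if k = Suc i then block 0 0 1 0
     else block 0 0 0 0)"


section \<open>Asymptotic expansions at infinity\<close>

definition sector_at_infinity :: "real \<Rightarrow> complex filter" where
  "sector_at_infinity \<epsilon> = inf at_infinity (principal {z. \<epsilon> < Arg z \<and> Arg z < pi - \<epsilon>})"

text \<open>\<open>\<Phi>(z) \<sim> - \<Sum>j\<ge>0. m\<^sub>j / z\<^bsup>j+1\<^esup>\<close>\<close>

definition has_asymptotic_expansion :: "(complex \<Rightarrow> complex) \<Rightarrow> (nat \<Rightarrow> real) \<Rightarrow> bool" where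
  "has_asymptotic_expansion \<Phi> m \<longleftrightarrow>
     (\<forall>\<epsilon>>0. \<forall>n. (\<lambda>z. \<Phi> z - (- (\<Sum>j\<le>n. of_real (m j) / z ^ (j + 1))))
        \<in> o[sector_at_infinity \<epsilon>](\<lambda>z. 1 / z ^ (n + 1)))"

text \<open>\<open>\<Phi>(z) = - s / z + O(1 / z\<^sup>2)\<close>\<close>

definition is_first_coeff :: "(complex \<Rightarrow> complex) \<Rightarrow> real \<Rightarrow> bool" where
  "is_first_coeff \<Phi> s \<longleftrightarrow>
     (\<forall>\<epsilon>>0. (\<lambda>z. \<Phi> z - (- of_real s / z)) \<in> O[sector_at_infinity \<epsilon>](\<lambda>z. 1 / z ^ 2))"

definition is_jacobi_matrix_of :: "smat \<Rightarrow> (complex \<Rightarrow> complex) \<Rightarrow> bool" where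
  "is_jacobi_matrix_of A \<Phi> \<longleftrightarrow>
     is_monic_jacobi A \<and>
     (\<exists>m. has_asymptotic_expansion \<Phi> m \<and>
          monic_orthogonal_polys (moment_functional m) (monic_polys A))"

end

(*
  Write x R_j = P_{j+1} + u_j P_j, where u_j = -P_{j+1}(0)/P_j(0) makes the right-hand side vanish
  at 0.  Together with P_{j+1} = R_{j+1} + l_{j+1} R_j this is, after substituting x^2 for x, the
  recurrence of the polynomials P_j(x^2), x R_j(x^2) with zero diagonal and subdiagonal
  u_0, l_1, u_1, l_2, ..., which is the matrix UL; eliminating the P_j gives the recurrence of the
  Darboux transformation for R_j.  Since mu lives on the half-line, F(x q^2) > 0 for q /= 0, whence
  P_j(0) /= 0 and u_j = F(x R_j^2) / F(P_j^2) > 0.  The functional with moments s_0, 0, s_1, 0, ...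
  sends p(x^2) to F(p) and x p(x^2) to 0, which gives orthogonality.  These are the moments of
  z S(z^2): expand 1/(t - z^2) as a geometric sum with remainder t^N / (z^(2N) (t - z^2)).
*)

theory Submission imports Defs
begin

section \<open>Substitution of a square\<close>

abbreviation sqX :: "real poly" where
  "sqX \<equiv> [:0, 0, 1:]"

lemma cpoly_pCons [simp]: "cpoly (pCons a p) z = of_real a + z * cpoly p z"
  by (simp add: cpoly_def map_poly_pCons)

lemma cpoly_0 [simp]: "cpoly 0 z = 0"
  by (simp add: cpoly_def)

lemma cpoly_add: "cpoly (p + q) z = cpoly p z + cpoly q z"
  by (induction p q rule: poly_induct2) (auto simp: algebra_simps)

lemma cpoly_smult: "cpoly (Polynomial.smult a p) z = of_real a * cpoly p z"
  by (induction p) (auto simp: algebra_simps)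

text \<open>Horner step in the variable x^2: two coefficient shifts instead of a product, the form
  in which the inductions below use the composition.\<close>

lemma pcompose_sqX_pCons: "pcompose (pCons a p) sqX = pCons a (pCons 0 (pcompose p sqX))"
  by (simp add: pcompose_pCons)

lemma cpoly_pcompose_sqX: "cpoly (pcompose p sqX) z = cpoly p (z\<^sup>2)"
  by (induction p) (auto simp: pcompose_sqX_pCons algebra_simps power2_eq_square simp del: pcompose_pCons)

text \<open>Multiplication by x shifts the moment sequence. The case \<open>p = 0\<close> is split
  off because the degree does not grow there.\<close>

lemma moment_functional_pCons:
  "moment_functional m (pCons a p) = a * m 0 + moment_functional (\<lambda>i. m (Suc i)) p"
  by (cases "p = 0")
     (simp_all add: moment_functional_def sum.atMost_Suc_shift del: sum.atMost_Suc)

lemma moment_functional_0 [simp]: "moment_functional m 0 = 0"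
  by (simp add: moment_functional_def)

text \<open>The induction leaves \<open>m\<close> arbitrary because each coefficient of
  \<open>p\<close> shifts the moments by two.\<close>

lemma moment_functional_pcompose_sqX:
  "moment_functional m (pcompose p sqX) = moment_functional (\<lambda>k. m (2 * k)) p"
  by (induction p arbitrary: m) (auto simp: pcompose_sqX_pCons moment_functional_pCons simp del: pcompose_pCons)

lemma moment_functional_zero_moments: "moment_functional (\<lambda>_. 0) p = 0"
  by (simp add: moment_functional_def)

text \<open>Products sorted by parity. Two odd factors leave x^2 over, which becomes the weight t
  after t = x^2.\<close>

lemma poly_sqX_arith:
  "pCons 0 (pcompose p sqX) * pcompose q sqX = pCons 0 (pcompose (p * q) sqX)"
  "pcompose p sqX * pCons 0 (pcompose q sqX) = pCons 0 (pcompose (p * q) sqX)"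
  "pCons 0 (pcompose p sqX) * pCons 0 (pcompose q sqX) = pcompose ([:0, 1:] * p * q) sqX"
  by (simp_all add: pcompose_mult pcompose_sqX_pCons)

section \<open>Entries of the block matrices\<close>

lemma smat_mult_finite:
  assumes "finite S" "\<And>j. j \<notin> S \<Longrightarrow> A i j = 0"
  shows "(A \<odot> B) i k = (\<Sum>j\<in>S. A i j * B j k)"
  unfolding smat_mult_def by (rule suminf_finite) (use assms in auto)

lemma block_entries [simp]:
  "block p q r s $$ (0, 0) = p" "block p q r s $$ (0, Suc 0) = q"
  "block p q r s $$ (Suc 0, 0) = r" "block p q r s $$ (Suc 0, Suc 0) = s"
  by (simp_all add: block_def mat_of_rows_list_def)

lemma parity_cases:
  fixes n :: nat
  obtains a where "n = 2 * a" | a where "n = Suc (2 * a)"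
  by (metis evenE oddE Suc_eq_plus1)

text \<open>The ones of the diagonal blocks sit at (2j, 2j+1), those of the off-diagonal blocks at
  (2j+1, 2j+2); together they fill the superdiagonal.\<close>

lemma gen_upper_entry:
  "gen_upper u i k = (if k = Suc i then 1 else if odd i \<and> i = Suc k then u (i div 2) else 0)"
  by (cases i rule: parity_cases; cases k rule: parity_cases)
     (auto simp: gen_upper_def of_blocks_def)

lemma gen_lower_entry:
  "gen_lower l i k = (if k = i then 1 else if odd i \<and> i = Suc (Suc k) then l (i div 2) else 0)"
  by (cases i rule: parity_cases; cases k rule: parity_cases)
     (auto simp: gen_lower_def of_blocks_def)

lemma gen_jacobi_entry:
  "gen_jacobi b c i k =
     (if k = Suc i then 1 else if odd i \<and> i = Suc k then b (i div 2)
      else if odd i \<and> i = Suc (Suc (Suc k)) then c (k div 2) else 0)"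
  by (cases i rule: parity_cases; cases k rule: parity_cases)
     (auto simp: gen_jacobi_def of_blocks_def)

text \<open>The hypotheses are the entrywise form of the classical factorization J = LU.\<close>

lemma gen_lower_mult_gen_upper:
  assumes "b 0 = u 0" "\<And>j. b (Suc j) = u (Suc j) + l (Suc j)" "\<And>j. c j = l (Suc j) * u j"
  shows "gen_lower l \<odot> gen_upper u = gen_jacobi b c"
proof (intro ext)
  fix i k
  \<comment> \<open>Truncated subtraction is harmless: for \<open>i = 0\<close> the set is
    \<open>{0}\<close>, and for \<open>i = 1\<close> the extra column 0 has entry 0.\<close>
  have "(gen_lower l \<odot> gen_upper u) i k = (\<Sum>j\<in>{i - 2, i}. gen_lower l i j * gen_upper u j k)"
    by (rule smat_mult_finite) (auto simp: gen_lower_entry)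
  also have "\<dots> = gen_jacobi b c i k"
  proof (cases i)
    case 0
    then show ?thesis by (simp add: gen_lower_entry gen_upper_entry gen_jacobi_entry)
  next
    case (Suc n)
    show ?thesis
    proof (cases n)
      case 0
      then show ?thesis using Suc assms
        by (simp add: gen_lower_entry gen_upper_entry gen_jacobi_entry)
    next
      case (Suc n')
      then show ?thesis using \<open>i = Suc n\<close> assms
        by (cases n' rule: parity_cases) (auto simp: gen_lower_entry gen_upper_entry gen_jacobi_entry)
    qed
  qed
  finally show "(gen_lower l \<odot> gen_upper u) i k = gen_jacobi b c i k" .
qed

definition interleave :: "(nat \<Rightarrow> real) \<Rightarrow> (nat \<Rightarrow> real) \<Rightarrow> nat \<Rightarrow> real" where
  "interleave u l i = (if even i then u (i div 2) else l (Suc (i div 2)))"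

text \<open>An odd row of the upper factor meets only even rows of the lower one, which are unit
  rows. An even row selects a single odd row, whose entry of \<open>l\<close> lands just below the
  diagonal of the product.\<close>

lemma gen_upper_mult_gen_lower:
  "gen_upper u \<odot> gen_lower l = jacobi_matrix (\<lambda>_. 0) (interleave u l)"
proof (intro ext)
  fix i k
  have "(gen_upper u \<odot> gen_lower l) i k = (\<Sum>j\<in>{i - 1, Suc i}. gen_upper u i j * gen_lower l j k)"
    by (rule smat_mult_finite) (auto simp: gen_upper_entry)
  also have "\<dots> = jacobi_matrix (\<lambda>_. 0) (interleave u l) i k"
    by (cases i) (auto simp: gen_lower_entry gen_upper_entry jacobi_matrix_def interleave_def elim!: evenE)
  finally show "(gen_upper u \<odot> gen_lower l) i k = jacobi_matrix (\<lambda>_. 0) (interleave u l) i k" .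
qed

lemma upper_bidiag_mult_lower_bidiag:
  "upper_bidiag u \<odot> lower_bidiag l = jacobi_matrix (\<lambda>j. u j + l (Suc j)) (\<lambda>j. u (Suc j) * l (Suc j))"
proof (intro ext)
  fix i k
  have "(upper_bidiag u \<odot> lower_bidiag l) i k = (\<Sum>j\<in>{i, Suc i}. upper_bidiag u i j * lower_bidiag l j k)"
    by (rule smat_mult_finite) (auto simp: upper_bidiag_def)
  also have "\<dots> = jacobi_matrix (\<lambda>j. u j + l (Suc j)) (\<lambda>j. u (Suc j) * l (Suc j)) i k"
    by (auto simp: lower_bidiag_def upper_bidiag_def jacobi_matrix_def)
  finally show "(upper_bidiag u \<odot> lower_bidiag l) i k
      = jacobi_matrix (\<lambda>j. u j + l (Suc j)) (\<lambda>j. u (Suc j) * l (Suc j)) i k" .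
qed

section \<open>Monic polynomials of a tridiagonal matrix\<close>

lemma monic_polys_jacobi_matrix_Suc_Suc:
  "monic_polys (jacobi_matrix \<beta> \<gamma>) (Suc (Suc j)) =
     [:- \<beta> (Suc j), 1:] * monic_polys (jacobi_matrix \<beta> \<gamma>) (Suc j)
     - Polynomial.smult (\<gamma> j) (monic_polys (jacobi_matrix \<beta> \<gamma>) j)"
  by (simp add: jacobi_matrix_def)

text \<open>The linear factor raises the degree by one; the subtracted multiple has degree at most
  \<open>j\<close> and leaves the leading term alone.\<close>

lemma monic_polys_monic:
  "degree (monic_polys A j) = j \<and> lead_coeff (monic_polys A j) = 1"
proof (induction A j rule: monic_polys.induct)
  case (3 A j)
  let ?p = "[:- A (Suc j) (Suc j), 1:] * monic_polys A (Suc j)"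
  let ?q = "Polynomial.smult (A (Suc j) j) (monic_polys A j)"
  have "monic_polys A (Suc j) \<noteq> 0" using 3 by auto
  then have deg_p: "degree ?p = Suc (Suc j)"
    using 3 by (subst degree_mult_eq) auto
  have "lead_coeff ?p = 1"
    using 3 by (subst lead_coeff_mult) auto
  note p = deg_p this
  have "degree ?q < Suc (Suc j)"
    using 3 by (auto simp: degree_smult_eq)
  then have "degree (?p - ?q) = Suc (Suc j)" "Polynomial.coeff ?q (Suc (Suc j)) = 0"
    using p degree_add_eq_left[of "- ?q" ?p]
    by (auto simp: coeff_eq_0 simp del: mult_pCons_left coeff_smult)
  with p show ?case by (simp del: mult_pCons_left)
qed auto

lemma degree_monic_polys: "degree (monic_polys A j) = j"
  and coeff_monic_polys: "Polynomial.coeff (monic_polys A j) j = 1"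
  using monic_polys_monic[of A j] by auto

section \<open>The Darboux transformation of a three-term recurrence\<close>

text \<open>The algebra of the factorization, kept apart from the measure: signs and integrals enter
  only later.\<close>

locale three_term =
  fixes P :: "nat \<Rightarrow> real poly" and b c :: "nat \<Rightarrow> real"
  assumes P_0: "P 0 = 1"
    and recurrence: "[:0, 1:] * P j =
           P (Suc j) + Polynomial.smult (b j) (P j) + (if j = 0 then 0 else Polynomial.smult (c (j - 1)) (P (j - 1)))"
    and P_at_0: "poly (P j) 0 \<noteq> 0"
begin

abbreviation "u \<equiv> darboux_u P"
abbreviation "l \<equiv> darboux_l P c"
abbreviation "R \<equiv> monic_polys (darboux P c)"
abbreviation "T \<equiv> monic_polys (gen_upper u \<odot> gen_lower l)"

lemma u_nonzero: "u j \<noteq> 0"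
  using P_at_0[of j] P_at_0[of "Suc j"] by (simp add: darboux_u_def)

lemma c_eq: "c j = l (Suc j) * u j"
  using u_nonzero[of j] by (simp add: darboux_l_def)

lemma b_0: "b 0 = u 0"
  using arg_cong[OF recurrence[of 0], of "\<lambda>p. poly p 0"] P_at_0[of 0]
  by (simp add: darboux_u_def P_0)

text \<open>At 0 the left side of the recurrence vanishes; dividing by P_{j+1}(0) turns the
  remaining quotients into \<open>u\<close> and \<open>l\<close>.\<close>

lemma b_Suc: "b (Suc j) = u (Suc j) + l (Suc j)"
  using arg_cong[OF recurrence[of "Suc j"], of "\<lambda>p. poly p 0"]
    P_at_0[of j] P_at_0[of "Suc j"] P_at_0[of "Suc (Suc j)"]
  by (simp add: darboux_u_def darboux_l_def field_simps)

text \<open>\<open>R j\<close> is the kernel polynomial of \<open>P\<close> at 0. The relations are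
  proved together because each induction step needs both.\<close>

lemma R_eqs: "pCons 0 (R j) = P (Suc j) + Polynomial.smult (u j) (P j) \<and>
              P (Suc j) = R (Suc j) + Polynomial.smult (l (Suc j)) (R j)"
proof (induction j)
  case 0
  have "[:0, 1:] = P (Suc 0) + [:u 0:]"
    using recurrence[of 0] by (simp add: P_0 b_0)
  then have "P (Suc 0) = [:0, 1:] - [:u 0:]"
    by (simp only: add_diff_cancel_right')
  then show ?case
    by (simp add: P_0 darboux_def upper_bidiag_mult_lower_bidiag jacobi_matrix_def one_pCons)
next
  case (Suc j)
  have R_Suc: "R (Suc j) = P (Suc j) - Polynomial.smult (l (Suc j)) (R j)"
    using Suc by simp
  have 1: "pCons 0 (R (Suc j)) = P (Suc (Suc j)) + Polynomial.smult (u (Suc j)) (P (Suc j))"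
  proof -
    have "pCons 0 (R (Suc j)) = pCons 0 (P (Suc j)) - Polynomial.smult (l (Suc j)) (pCons 0 (R j))"
      by (simp add: R_Suc)
    \<comment> \<open>With b and c written through \<open>u\<close> and \<open>l\<close>, the terms
      containing \<open>l (Suc j)\<close> are exactly \<open>l (Suc j)\<close> times x R_j and
      cancel.\<close>
    also have "pCons 0 (P (Suc j)) = P (Suc (Suc j)) + Polynomial.smult (u (Suc j) + l (Suc j)) (P (Suc j))
         + Polynomial.smult (l (Suc j) * u j) (P j)"
      using recurrence[of "Suc j"] by (simp add: b_Suc c_eq)
    finally show ?thesis using Suc
      by (simp add: smult_add_left smult_add_right algebra_simps)
  qed
  have "R (Suc (Suc j)) = [:- (u (Suc j) + l (Suc (Suc j))), 1:] * R (Suc j)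
          - Polynomial.smult (u (Suc j) * l (Suc j)) (R j)"
    by (simp only: darboux_def upper_bidiag_mult_lower_bidiag monic_polys_jacobi_matrix_Suc_Suc)
  \<comment> \<open>Regrouped so that \<open>u (Suc j)\<close> multiplies the induction hypothesis
    for P_{j+1}; fact \<open>1\<close> then absorbs that term.\<close>
  also have "\<dots> = pCons 0 (R (Suc j)) - Polynomial.smult (u (Suc j)) (R (Suc j) + Polynomial.smult (l (Suc j)) (R j))
          - Polynomial.smult (l (Suc (Suc j))) (R (Suc j))"
    by (simp add: smult_add_left smult_diff_left smult_add_right algebra_simps del: monic_polys.simps)
  also have "R (Suc j) + Polynomial.smult (l (Suc j)) (R j) = P (Suc j)"
    using Suc by simp
  finally show ?case using 1 by simp
qed

lemmas pCons_R = R_eqs[THEN conjunct1]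
lemmas R_Suc = R_eqs[THEN conjunct2]

text \<open>Each induction step takes two recurrence steps: the one with \<open>u j\<close> uses the
  first relation of \<open>R_eqs\<close>, the one with \<open>l (Suc j)\<close> the second.\<close>

lemma T_eqs: "T (2 * j) = pcompose (P j) sqX \<and> T (Suc (2 * j)) = pCons 0 (pcompose (R j) sqX)"
proof (induction j)
  case 0
  show ?case by (simp add: P_0 gen_upper_mult_gen_lower jacobi_matrix_def pcompose_1)
next
  case (Suc j)
  have step: "T (Suc (Suc n)) = pCons 0 (T (Suc n)) - Polynomial.smult (interleave u l n) (T n)" for n
    by (simp add: gen_upper_mult_gen_lower monic_polys_jacobi_matrix_Suc_Suc del: monic_polys.simps)
  have "pcompose (pCons 0 (R j)) sqX = pcompose (P (Suc j) + Polynomial.smult (u j) (P j)) sqX"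
    by (simp only: pCons_R)
  then have "T (Suc (Suc (2 * j))) = pcompose (P (Suc j)) sqX"
    using Suc by (simp only: step)
      (simp add: pcompose_sqX_pCons pcompose_add pcompose_smult interleave_def algebra_simps del: pcompose_pCons)
  moreover from this have "T (Suc (Suc (Suc (2 * j)))) = pCons 0 (pcompose (R (Suc j)) sqX)"
    using Suc by (simp only: step[of "Suc (2 * j)"])
      (simp add: R_Suc[of j] pcompose_add pcompose_smult interleave_def algebra_simps del: monic_polys.simps)
  ultimately show ?case by simp
qed

lemma T_even: "T (2 * j) = pcompose (P j) sqX"
  and T_odd: "T (Suc (2 * j)) = pCons 0 (pcompose (R j) sqX)"
  using T_eqs by auto

end

section \<open>Measures on the half-line\<close>

locale half_line_measure =
  fixes \<mu> :: "real measure" and P :: "nat \<Rightarrow> real poly"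
  assumes nontrivial: "nontrivial_prob_measure \<mu>"
    and supp: "emeasure \<mu> {..<0} = 0"
    and orth: "monic_orthogonal_polys (measure_functional \<mu>) P"
begin

sublocale prob_space \<mu>
  using nontrivial by (simp add: nontrivial_prob_measure_def)

abbreviation "F \<equiv> measure_functional \<mu>"

lemma sets_eq [measurable_cong]: "sets \<mu> = sets borel"
  using nontrivial by (simp add: nontrivial_prob_measure_def)

lemma integrable_power: "integrable \<mu> (\<lambda>t. t ^ j)"
  using nontrivial by (simp add: nontrivial_prob_measure_def)

lemma integrable_poly: "integrable \<mu> (poly p)"
  unfolding poly_altdef[abs_def] by (intro Bochner_Integration.integrable_sum integrable_mult_right integrable_power)

lemma AE_nonneg: "AE t in \<mu>. 0 \<le> t"
  by (rule AE_I'[of "{..<0}"]) (auto simp: null_sets_def supp sets_eq)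

lemma F_0: "F 0 = 0"
  by (simp add: measure_functional_def)

lemma F_add: "F (p + q) = F p + F q"
  by (simp add: measure_functional_def integrable_poly)

lemma F_smult: "F (Polynomial.smult a p) = a * F p"
  by (simp add: measure_functional_def)

lemma F_eq_moment_functional: "F p = moment_functional (moment \<mu>) p"
  unfolding measure_functional_def poly_altdef moment_functional_def moment_def
  by (subst Bochner_Integration.integral_sum) (auto intro: integrable_mult_right integrable_power)

lemma degree_P: "degree (P j) = j" and coeff_P: "Polynomial.coeff (P j) j = 1"
  and F_P_P: "j \<noteq> k \<Longrightarrow> F (P j * P k) = 0" and F_P_sq: "F (P j * P j) \<noteq> 0"
  using orth by (auto simp: monic_orthogonal_polys_def) metis

lemma P_0_eq: "P 0 = 1"
  using degree_P[of 0] coeff_P[of 0] by (metis degree_0_id of_nat_1 one_poly_eq_simps(1) pCons_one)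

text \<open>Cancels the leading term. The zero polynomial is a separate case, since its degree is
  not below \<open>n\<close> when \<open>n = 0\<close>.\<close>

lemma degree_less_split:
  assumes "degree p \<le> n"
  shows "degree (p - Polynomial.smult (Polynomial.coeff p n) (P n)) < n
         \<or> p - Polynomial.smult (Polynomial.coeff p n) (P n) = 0"
proof -
  let ?q = "p - Polynomial.smult (Polynomial.coeff p n) (P n)"
  have "degree ?q \<le> n"
    using assms degree_P[of n] by (intro degree_diff_le) (auto intro: order_trans[OF degree_smult_le])
  moreover have "Polynomial.coeff ?q n = 0"
    by (simp add: coeff_P)
  ultimately show ?thesis
    by (metis le_neq_implies_less leading_coeff_0_iff)
qed

text \<open>Peeling off leading terms expands \<open>p\<close> in the \<open>P k\<close> with
  \<open>k < n\<close>, all orthogonal to \<open>P n\<close>.\<close>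

lemma F_P_lower_degree: "degree p < n \<Longrightarrow> F (P n * p) = 0"
proof (induction "degree p" arbitrary: p rule: less_induct)
  case less
  let ?a = "Polynomial.coeff p (degree p)"
  let ?q = "p - Polynomial.smult ?a (P (degree p))"
  have q: "F (P n * ?q) = 0"
    using degree_less_split[of p "degree p", OF order_refl]
  proof
    assume "degree ?q < degree p"
    then show ?thesis using less by simp
  next
    assume "?q = 0"
    then show ?thesis by (simp only: mult_zero_right F_0)
  qed
  have "P n * p = P n * ?q + Polynomial.smult ?a (P n * P (degree p))"
    by (simp add: algebra_simps)
  then have "F (P n * p) = F (P n * ?q) + ?a * F (P n * P (degree p))"
    by (simp only: F_add F_smult)
  then show ?case using q F_P_P[of n "degree p"] less.prems by simp
qed

lemma F_P_same_degree:
  assumes "degree p = n"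
  shows "F (P n * p) = Polynomial.coeff p n * F (P n * P n)"
proof -
  let ?a = "Polynomial.coeff p n"
  let ?q = "p - Polynomial.smult ?a (P n)"
  have q: "F (P n * ?q) = 0"
    using degree_less_split[OF eq_refl[OF assms]]
  proof
    assume "?q = 0"
    then show ?thesis by (simp only: mult_zero_right F_0)
  qed (rule F_P_lower_degree)
  have "P n * p = P n * ?q + Polynomial.smult ?a (P n * P n)"
    by (simp add: algebra_simps)
  then have "F (P n * p) = F (P n * ?q) + ?a * F (P n * P n)"
    by (simp only: F_add F_smult)
  with q show ?thesis by simp
qed

lemma F_P_sq_pos: "F (P j * P j) > 0"
proof -
  have "F (P j * P j) \<ge> 0"
    unfolding measure_functional_def by (intro integral_nonneg_AE) simp
  with F_P_sq[of j] show ?thesis by simp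
qed

text \<open>If the integral vanished, x q would be 0 almost everywhere, yet its pairing with the
  \<open>P n\<close> of the same degree is a nonzero multiple of F(P_n^2).\<close>

lemma F_X_sq_pos:
  assumes "q \<noteq> 0"
  shows "F ([:0, 1:] * q * q) > 0"
proof -
  let ?p = "[:0, 1:] * q"
  let ?n = "degree ?p"
  have nonneg: "AE t in \<mu>. 0 \<le> poly (?p * q) t"
    using AE_nonneg by eventually_elim (simp add: mult.assoc)
  have "F (?p * q) \<noteq> 0"
  proof
    assume "F (?p * q) = 0"
    then have "AE t in \<mu>. poly (?p * q) t = 0"
      using integral_nonneg_eq_0_iff_AE[OF integrable_poly nonneg] by (simp add: measure_functional_def)
    then have "AE t in \<mu>. poly (P ?n * ?p) t = 0"
      by eventually_elim auto
    then have "F (P ?n * ?p) = 0"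
      unfolding measure_functional_def by (rule integral_eq_zero_AE)
    moreover have "F (P ?n * ?p) = lead_coeff ?p * F (P ?n * P ?n)"
      by (rule F_P_same_degree) simp
    ultimately show False
      using assms F_P_sq[of ?n] by simp
  qed
  moreover have "F (?p * q) \<ge> 0"
    unfolding measure_functional_def using nonneg by (rule integral_nonneg_AE)
  ultimately show ?thesis by simp
qed

text \<open>If P_j = x q, orthogonality to the lower-degree \<open>q\<close> would give F(x q^2) =
  0.\<close>

lemma P_at_0_nonzero: "poly (P j) 0 \<noteq> 0"
proof
  assume "poly (P j) 0 = 0"
  then obtain q where q: "P j = [:0, 1:] * q"
    using poly_eq_0_iff_dvd[of "P j" 0] by auto
  have "P j \<noteq> 0"
    using coeff_P[of j] by auto
  then have "q \<noteq> 0"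
    using q by auto
  then have "degree q < j"
    using degree_P[of j] by (simp add: q)
  then show False
    using F_P_lower_degree[of q j] F_X_sq_pos[OF \<open>q \<noteq> 0\<close>] by (simp add: q)
qed

end

section \<open>Positivity and orthogonality for the transformed polynomials\<close>

locale half_line_jacobi = half_line_measure +
  fixes b c
  assumes c_pos: "c j > 0"
    and recurrence': "[:0, 1:] * P j =
           P (Suc j) + Polynomial.smult (b j) (P j) + (if j = 0 then 0 else Polynomial.smult (c (j - 1)) (P (j - 1)))"
begin

sublocale three_term P b c
  using P_0_eq recurrence' P_at_0_nonzero by unfold_locales

lemma degree_R: "degree (R j) = j" and coeff_R: "Polynomial.coeff (R j) j = 1"
  by (rule degree_monic_polys coeff_monic_polys)+

text \<open>Trades the weight x for pairings with \<open>P\<close>, where orthogonality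
  applies.\<close>

lemma F_X_R: "F ([:0, 1:] * R j * p) = F (P (Suc j) * p) + u j * F (P j * p)"
proof -
  have "[:0, 1:] * R j * p = P (Suc j) * p + Polynomial.smult (u j) (P j * p)"
    using pCons_R[of j] by (simp add: algebra_simps)
  then show ?thesis by (simp only: F_add F_smult)
qed

lemma F_R_sq_pos: "F ([:0, 1:] * R j * R j) > 0"
  using coeff_R[of j] by (intro F_X_sq_pos) auto

text \<open>For \<open>k < j\<close> the polynomial \<open>R k\<close> is orthogonal to both P_{j+1}
  and P_j; the other order follows by symmetry.\<close>

lemma F_R_R:
  assumes "j \<noteq> k"
  shows "F ([:0, 1:] * R j * R k) = 0"
proof -
  have *: "F ([:0, 1:] * R j * R k) = 0" if "k < j" for j k
    by (subst F_X_R) (use that in \<open>simp add: F_P_lower_degree degree_R\<close>)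
  show ?thesis
    using *[of j k] *[of k j] assms by (cases "k < j") (auto simp: ac_simps)
qed

lemma u_pos: "u j > 0"
proof -
  have "F ([:0, 1:] * R j * R j) = u j * F (P j * P j)"
    by (subst F_X_R) (simp add: F_P_lower_degree F_P_same_degree degree_R coeff_R)
  then show ?thesis
    using F_R_sq_pos[of j] F_P_sq_pos[of j] by (simp add: zero_less_mult_iff)
qed

lemma l_pos: "l (Suc j) > 0"
  using u_pos[of j] c_pos[of j] by (simp add: darboux_l_def)

text \<open>Moments of the symmetric measure whose image under squaring is \<open>\<mu>\<close>.
  That measure is never constructed; its functional suffices.\<close>

definition sqrt_moment :: "nat \<Rightarrow> real" where
  "sqrt_moment i = (if even i then moment \<mu> (i div 2) else 0)"

lemma moment_functional_sqrt_moment: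
  "moment_functional sqrt_moment (pcompose p sqX) = F p"
  "moment_functional sqrt_moment (pCons 0 (pcompose p sqX)) = 0"
  by (simp_all add: moment_functional_pcompose_sqX moment_functional_pCons F_eq_moment_functional
        sqrt_moment_def moment_functional_zero_moments)

text \<open>By parity of the indices: even pairs reduce to \<open>P\<close> under \<open>F\<close>,
  odd pairs to \<open>R\<close> under the weight x, and mixed products are odd polynomials.\<close>

lemma T_orthogonal: "monic_orthogonal_polys (moment_functional sqrt_moment) T"
  unfolding monic_orthogonal_polys_def
proof (intro conjI allI impI)
  fix j k :: nat
  show "degree (T j) = j" "lead_coeff (T j) = 1"
    by (simp_all add: degree_monic_polys coeff_monic_polys)
  show "moment_functional sqrt_moment (T j * T k) = 0" if "j \<noteq> k"
    using that
    by (cases j rule: parity_cases; cases k rule: parity_cases)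
       (simp_all only: T_even T_odd poly_sqX_arith pcompose_mult[symmetric] moment_functional_sqrt_moment,
        simp_all add: F_P_P F_R_R del: mult_pCons_left)
  show "moment_functional sqrt_moment (T j * T j) \<noteq> 0"
    using F_P_sq F_R_sq_pos[THEN less_imp_neq, THEN not_sym]
    by (cases j rule: parity_cases)
       (simp_all only: T_even T_odd poly_sqX_arith pcompose_mult[symmetric] moment_functional_sqrt_moment,
        simp_all del: mult_pCons_left)
qed

lemma is_monic_jacobi_UL: "is_monic_jacobi (gen_upper u \<odot> gen_lower l)"
  unfolding is_monic_jacobi_def gen_upper_mult_gen_lower
  by (intro exI[of _ "\<lambda>_. 0"] exI[of _ "interleave u l"]) (auto simp: interleave_def u_pos l_pos)

end

section \<open>Asymptotics in sectors\<close>

lemma eventually_sector_at_infinity: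
  assumes "\<And>z. 1 \<le> norm z \<Longrightarrow> \<epsilon> < Arg z \<Longrightarrow> Arg z < pi - \<epsilon> \<Longrightarrow> Q z"
  shows "eventually Q (sector_at_infinity \<epsilon>)"
  unfolding sector_at_infinity_def eventually_inf_principal eventually_at_infinity
  using assms by (intro exI[of _ 1]) auto

text \<open>The positive imaginary axis stays in the sector. Along a trivial filter, coefficients
  would not be unique.\<close>

lemma sector_at_infinity_nontrivial:
  assumes "\<epsilon> < pi / 2"
  shows "sector_at_infinity \<epsilon> \<noteq> bot"
proof
  assume "sector_at_infinity \<epsilon> = bot"
  then have "eventually (\<lambda>_. False) (sector_at_infinity \<epsilon>)"
    by simp
  then obtain B where B: "\<And>z. B \<le> norm z \<Longrightarrow> \<not> (\<epsilon> < Arg z \<and> Arg z < pi - \<epsilon>)"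
    unfolding sector_at_infinity_def eventually_inf_principal eventually_at_infinity by auto
  let ?z = "of_real (max B 1) * \<i>"
  have "Arg ?z = pi / 2"
    by (subst Arg_times_of_real) auto
  moreover have "B \<le> norm ?z"
    by (simp add: norm_mult)
  ultimately show False
    using B[of ?z] assms by auto
qed

text \<open>With \<open>t = r\<^sup>2\<close> one has \<open>t - w\<^sup>2 = (r - w) (r + w)\<close>, and each factor is at least \<open>\<bar>Im w\<bar>\<close>.\<close>

lemma norm_diff_square_ge:
  fixes t :: real
  assumes "0 < \<epsilon>" "\<epsilon> < Arg w" "Arg w < pi - \<epsilon>" "0 \<le> t"
  shows "(sin \<epsilon>)\<^sup>2 * norm (w\<^sup>2) \<le> norm (of_real t - w\<^sup>2)"
proof -
  \<comment> \<open>Sine increases only up to pi/2; a larger argument is first reflected.\<close>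
  have sin_le: "sin \<epsilon> \<le> sin (Arg w)"
  proof (cases "Arg w \<le> pi / 2")
    case True
    then show ?thesis using assms by (intro sin_monotone_2pi_le) auto
  next
    case False
    then have "sin \<epsilon> \<le> sin (pi - Arg w)" using assms by (intro sin_monotone_2pi_le) auto
    then show ?thesis by simp
  qed
  have "0 < sin \<epsilon>"
    using assms by (intro sin_gt_zero) auto
  have "norm w * sin \<epsilon> \<le> Im w"
  proof (cases "w = 0")
    case False
    then have "Im w = norm w * sin (Arg w)"
      by (simp add: sin_Arg)
    then show ?thesis using sin_le by (simp add: mult_left_mono)
  qed simp
  moreover have "Im w \<le> norm (of_real (sqrt t) - w)" "Im w \<le> norm (of_real (sqrt t) + w)"
    using abs_Im_le_cmod[of "of_real (sqrt t) - w"] abs_Im_le_cmod[of "of_real (sqrt t) + w"] by auto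
  ultimately have "(norm w * sin \<epsilon>) * (norm w * sin \<epsilon>)
      \<le> norm (of_real (sqrt t) - w) * norm (of_real (sqrt t) + w)"
    using \<open>0 < sin \<epsilon>\<close> by (intro mult_mono) auto
  also have "\<dots> = norm (of_real (sqrt t * sqrt t) - w\<^sup>2)"
    by (simp only: norm_mult[symmetric] of_real_mult) (simp add: algebra_simps power2_eq_square)
  finally show ?thesis
    using assms by (simp add: norm_mult power2_eq_square ac_simps)
qed

text \<open>Adding one more term multiplies the remainder by t/z.\<close>

lemma geometric_remainder:
  fixes t z :: complex
  assumes "z \<noteq> 0" "t \<noteq> z"
  shows "1 / (t - z) + (\<Sum>k<N. t ^ k / z ^ (k + 1)) = t ^ N / (z ^ N * (t - z))"
proof (induction N)
  case (Suc N)
  have "1 / (t - z) + (\<Sum>k<Suc N. t ^ k / z ^ (k + 1)) = t ^ N / (z ^ N * (t - z)) + t ^ N / z ^ (N + 1)"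
    using Suc by (simp add: add.assoc[symmetric])
  also have "\<dots> = t ^ Suc N / (z ^ Suc N * (t - z))"
    using assms by (simp add: divide_simps) (simp add: algebra_simps)
  finally show ?case .
qed simp

section \<open>Remainder estimates for the Stieltjes transform\<close>

context half_line_measure
begin

lemma moment_nonneg: "0 \<le> moment \<mu> N"
  unfolding moment_def using AE_nonneg by (intro integral_nonneg_AE) (auto elim: eventually_mono)

text \<open>\<open>far\<close> bounds the kernel, hence both its integrability and the remainder,
  whose integral is then controlled by the moment of order \<open>N\<close>.\<close>

lemma stieltjes_remainder:
  assumes "0 < \<delta>" "z \<noteq> 0" and far: "\<And>t. 0 \<le> t \<Longrightarrow> \<delta> * norm z \<le> norm (complex_of_real t - z)"
  shows "norm (stieltjes \<mu> z + (\<Sum>k<N. of_real (moment \<mu> k) / z ^ (k + 1)))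
           \<le> moment \<mu> N / (\<delta> * norm z ^ (N + 1))"
proof -
  let ?g = "\<lambda>t. indicat_real {0..} t *\<^sub>R (1 / (complex_of_real t - z))"
  \<comment> \<open>Only the kernel carries the indicator; the powers are integrated over the whole
    line. On the half-line, which has full measure, the geometric identity applies to the
    sum.\<close>
  let ?h = "\<lambda>t. ?g t + (\<Sum>k<N. of_real (t ^ k) / z ^ (k + 1))"
  have pos: "0 < \<delta> * norm z" using assms by simp
  have ne: "complex_of_real t \<noteq> z" if "0 \<le> t" for t
    using far[OF that] pos by auto
  have g: "integrable \<mu> ?g"
  proof (rule Bochner_Integration.integrable_bound[of \<mu> "\<lambda>_. 1 / (\<delta> * norm z)"])
    have "norm (?g t) \<le> 1 / (\<delta> * norm z)" for t
      using far[of t] pos by (cases "0 \<le> t") (auto simp: norm_divide intro!: frac_le)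
    then show "AE t in \<mu>. norm (?g t) \<le> norm (1 / (\<delta> * norm z))"
      using pos by (intro AE_I2) (simp only: real_norm_def abs_of_pos zero_less_divide_1_iff)
  qed auto
  have pw: "integrable \<mu> (\<lambda>t. complex_of_real (t ^ k) / z ^ (k + 1))" for k
    using integrable_power[of k] by (intro integrable_divide integrable_of_real)
  have "stieltjes \<mu> z + (\<Sum>k<N. of_real (moment \<mu> k) / z ^ (k + 1)) = integral\<^sup>L \<mu> ?h"
    using g pw by (simp add: stieltjes_def set_lebesgue_integral_def moment_def
        Bochner_Integration.integral_add Bochner_Integration.integral_sum integral_complex_of_real[symmetric]
        del: integral_complex_of_real of_real_power)
  also have "norm \<dots> \<le> (LINT t|\<mu>. norm (?h t))"
    by (rule integral_norm_bound)
  also have "\<dots> \<le> (LINT t|\<mu>. t ^ N / (\<delta> * norm z ^ (N + 1)))"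
  proof (rule integral_mono_AE)
    show "integrable \<mu> (\<lambda>t. norm (?h t))"
      using g pw by (intro integrable_norm Bochner_Integration.integrable_add Bochner_Integration.integrable_sum)
    show "integrable \<mu> (\<lambda>t. t ^ N / (\<delta> * norm z ^ (N + 1)))"
      using integrable_power by simp
    show "AE t in \<mu>. norm (?h t) \<le> t ^ N / (\<delta> * norm z ^ (N + 1))"
      using AE_nonneg
    proof eventually_elim
      fix t :: real assume t: "0 \<le> t"
      have "norm (?h t) = norm (of_real t ^ N / (z ^ N * (of_real t - z)))"
        using t geometric_remainder[OF \<open>z \<noteq> 0\<close> ne[OF t], of N] by simp
      also have "\<dots> = t ^ N / (norm z ^ N * norm (of_real t - z))"
        using t by (simp add: norm_divide norm_mult norm_power)
      also have "\<dots> \<le> t ^ N / (norm z ^ N * (\<delta> * norm z))"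
        using t far[OF t] assms(1,2) by (intro divide_left_mono mult_left_mono mult_pos_pos) (auto simp: ne)
      finally show "norm (?h t) \<le> t ^ N / (\<delta> * norm z ^ (N + 1))"
        by (simp add: ac_simps)
    qed
  qed
  finally show ?thesis by (simp add: moment_def)
qed

lemma stieltjes_square_remainder:
  assumes "0 < \<epsilon>"
  shows "(\<lambda>z. stieltjes \<mu> (z\<^sup>2) + (\<Sum>k<N. of_real (moment \<mu> k) / z ^ (2 * k + 2)))
           \<in> O[sector_at_infinity \<epsilon>](\<lambda>z. 1 / z ^ (2 * N + 2))"
proof (rule landau_o.bigI)
  \<comment> \<open>The added 1 makes the constant positive, as only nonnegativity of the moment is
    at hand.\<close>
  show "eventually (\<lambda>z. norm (stieltjes \<mu> (z\<^sup>2) + (\<Sum>k<N. of_real (moment \<mu> k) / z ^ (2 * k + 2)))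
      \<le> (moment \<mu> N / (sin \<epsilon>)\<^sup>2 + 1) * norm (1 / z ^ (2 * N + 2))) (sector_at_infinity \<epsilon>)"
  proof (rule eventually_sector_at_infinity)
    fix z :: complex assume z: "1 \<le> norm z" "\<epsilon> < Arg z" "Arg z < pi - \<epsilon>"
    \<comment> \<open>A point of the sector forces \<epsilon> < pi - \<epsilon>.\<close>
    have "0 < sin \<epsilon>"
      using assms z by (intro sin_gt_zero) auto
    then have "norm (stieltjes \<mu> (z\<^sup>2) + (\<Sum>k<N. of_real (moment \<mu> k) / (z\<^sup>2) ^ (k + 1)))
        \<le> moment \<mu> N / ((sin \<epsilon>)\<^sup>2 * norm (z\<^sup>2) ^ (N + 1))"
      using z norm_diff_square_ge[OF assms z(2,3)] by (intro stieltjes_remainder) auto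
    moreover have pow: "(z\<^sup>2) ^ (k + 1) = z ^ (2 * k + 2)" for k
      by (simp only: power_mult[symmetric] distrib_left mult_1_right)
    ultimately have "norm (stieltjes \<mu> (z\<^sup>2) + (\<Sum>k<N. of_real (moment \<mu> k) / z ^ (2 * k + 2)))
        \<le> moment \<mu> N / ((sin \<epsilon>)\<^sup>2 * norm (z ^ (2 * N + 2)))"
      by (simp only: norm_power[of "z\<^sup>2", symmetric] pow)
    also have "\<dots> = moment \<mu> N / (sin \<epsilon>)\<^sup>2 * norm (1 / z ^ (2 * N + 2))"
      by (simp only: norm_divide norm_one times_divide_times_eq mult_1_right)
    also have "\<dots> \<le> (moment \<mu> N / (sin \<epsilon>)\<^sup>2 + 1) * norm (1 / z ^ (2 * N + 2))"
      by (intro mult_right_mono) auto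
    finally show "norm (stieltjes \<mu> (z\<^sup>2) + (\<Sum>k<N. of_real (moment \<mu> k) / z ^ (2 * k + 2))) \<le> \<dots>" .
  qed
  show "0 < moment \<mu> N / (sin \<epsilon>)\<^sup>2 + 1"
    using moment_nonneg[of N] by (simp add: add_nonneg_pos)
qed

text \<open>For \<open>N = 0\<close> the sum is empty and the error has order z^(-2).\<close>

lemma first_coeff_stieltjes_square: "is_first_coeff (\<lambda>z. stieltjes \<mu> (z\<^sup>2)) 0"
  using stieltjes_square_remainder[of _ 0] by (simp add: is_first_coeff_def power2_eq_square)

end

section \<open>Uniqueness of the first coefficient\<close>

lemma inverse_power_Suc_smallo:
  "(\<lambda>z::complex. 1 / z ^ Suc n) \<in> o[sector_at_infinity \<epsilon>](\<lambda>z. 1 / z ^ n)"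
proof (rule smalloI_tendsto)
  have lim: "((\<lambda>z::complex. inverse z) \<longlongrightarrow> 0) (sector_at_infinity \<epsilon>)"
    unfolding sector_at_infinity_def by (rule tendsto_mono[OF inf_le1 tendsto_inverse_0])
  have nz: "eventually (\<lambda>z. z \<noteq> 0) (sector_at_infinity \<epsilon>)"
    by (rule eventually_sector_at_infinity) auto
  from nz have "eventually (\<lambda>z. inverse z = (1 / z ^ Suc n) / (1 / z ^ n)) (sector_at_infinity \<epsilon>)"
    by eventually_elim (simp add: field_simps)
  with lim show "((\<lambda>z. (1 / z ^ Suc n) / (1 / z ^ n)) \<longlongrightarrow> 0) (sector_at_infinity \<epsilon>)"
    by (rule Lim_transform_eventually)
  from nz show "eventually (\<lambda>z. 1 / z ^ n \<noteq> 0) (sector_at_infinity \<epsilon>)"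
    by eventually_elim simp
qed

text \<open>Otherwise (s - s')/z would be O(z^(-2)), making 1/z negligible against itself and so
  eventually 0.\<close>

lemma is_first_coeff_unique:
  assumes "is_first_coeff \<Phi> s" "is_first_coeff \<Phi> s'"
  shows "s = s'"
proof (rule ccontr)
  assume "s \<noteq> s'"
  \<comment> \<open>The aperture 1 is below pi/2, so this filter is nontrivial.\<close>
  define G where "G = sector_at_infinity 1"
  have "(\<lambda>z. (\<Phi> z - - of_real s / z) - (\<Phi> z - - of_real s' / z)) \<in> O[G](\<lambda>z. 1 / z ^ 2)"
    by (rule sum_in_bigo(2)) (use assms in \<open>simp_all add: is_first_coeff_def G_def\<close>)
  also have "(\<lambda>z. (\<Phi> z - - of_real s / z) - (\<Phi> z - - of_real s' / z)) = (\<lambda>z. of_real (s - s') * (1 / z))"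
    by (auto simp: diff_divide_distrib)
  finally have "(\<lambda>z. of_real (s - s') * (1 / z)) \<in> O[G](\<lambda>z. 1 / z ^ 2)" .
  then have "(\<lambda>z. 1 / z) \<in> O[G](\<lambda>z::complex. 1 / z ^ 2)"
    using \<open>s \<noteq> s'\<close> by (subst (asm) landau_o.big.cmult_in_iff) auto
  also have "(\<lambda>z::complex. 1 / z ^ 2) \<in> o[G](\<lambda>z. 1 / z)"
    using inverse_power_Suc_smallo[of 1 1] by (simp add: G_def power2_eq_square)
  finally have "eventually (\<lambda>z::complex. 1 / z = 0) G"
    by (simp add: landau_o.small_refl_iff)
  moreover have "eventually (\<lambda>z. z \<noteq> 0) G"
    unfolding G_def by (rule eventually_sector_at_infinity) auto
  ultimately have "eventually (\<lambda>_. False) G"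
    by eventually_elim simp
  moreover have "(1::real) < pi / 2"
    using pi_gt3 by simp
  ultimately show False
    using sector_at_infinity_nontrivial[of 1] by (simp add: G_def eventually_False)
qed

section \<open>Asymptotic expansion of z S(z^2)\<close>

context half_line_jacobi
begin

lemma sum_sqrt_moment:
  "(\<Sum>j\<le>n. of_real (sqrt_moment j) * a j) =
   (\<Sum>k<Suc (n div 2). of_real (moment \<mu> k) * (a (2 * k) :: complex))"
proof (induction n)
  case (Suc n)
  then show ?case
    by (cases n rule: parity_cases) (auto simp: sqrt_moment_def)
qed (simp add: sqrt_moment_def)

lemma asymptotic_expansion:
  "has_asymptotic_expansion (\<lambda>z. z * stieltjes \<mu> (z\<^sup>2)) sqrt_moment"
  unfolding has_asymptotic_expansion_def
proof (intro allI impI)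
  fix \<epsilon> :: real and n :: nat assume "0 < \<epsilon>"
  \<comment> \<open>The number of even indices up to \<open>n\<close>. As 2N + 1 >= n + 2, the error
    after multiplication by z is O(z^(-n-2)), one power better than required.\<close>
  define N where "N = Suc (n div 2)"
  let ?G = "sector_at_infinity \<epsilon>"
  have nz: "eventually (\<lambda>z. z \<noteq> 0) ?G"
    by (rule eventually_sector_at_infinity) auto
  have "eventually (\<lambda>z. z * stieltjes \<mu> (z\<^sup>2) - (- (\<Sum>j\<le>n. of_real (sqrt_moment j) / z ^ (j + 1)))
      = z * (stieltjes \<mu> (z\<^sup>2) + (\<Sum>k<N. of_real (moment \<mu> k) / z ^ (2 * k + 2)))) ?G"
    using nz
  proof eventually_elim
    fix z :: complex assume "z \<noteq> 0"
    then show "z * stieltjes \<mu> (z\<^sup>2) - (- (\<Sum>j\<le>n. of_real (sqrt_moment j) / z ^ (j + 1)))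
      = z * (stieltjes \<mu> (z\<^sup>2) + (\<Sum>k<N. of_real (moment \<mu> k) / z ^ (2 * k + 2)))"
      using sum_sqrt_moment[of "\<lambda>j. 1 / z ^ (j + 1)" n]
      by (simp add: N_def distrib_left sum_distrib_left)
  qed
  moreover have "(\<lambda>z. z * (stieltjes \<mu> (z\<^sup>2) + (\<Sum>k<N. of_real (moment \<mu> k) / z ^ (2 * k + 2))))
      \<in> o[?G](\<lambda>z. 1 / z ^ (n + 1))"
  proof -
    have "(\<lambda>z. z * (stieltjes \<mu> (z\<^sup>2) + (\<Sum>k<N. of_real (moment \<mu> k) / z ^ (2 * k + 2))))
        \<in> O[?G](\<lambda>z. z * (1 / z ^ (2 * N + 2)))"
      using stieltjes_square_remainder[OF \<open>0 < \<epsilon>\<close>] by (intro landau_o.big.mult_left)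
    also have "(\<lambda>z. z * (1 / z ^ (2 * N + 2))) \<in> O[?G](\<lambda>z. 1 / z ^ Suc (n + 1))"
    proof (rule landau_o.bigI[of 1])
      show "eventually (\<lambda>z. norm (z * (1 / z ^ (2 * N + 2))) \<le> 1 * norm (1 / z ^ Suc (n + 1))) ?G"
      proof (rule eventually_sector_at_infinity)
        fix z :: complex assume z: "1 \<le> norm z"
        then have "norm (z * (1 / z ^ (2 * N + 2))) = 1 / norm z ^ (2 * N + 1)"
          by (auto simp: norm_mult norm_divide norm_power field_simps)
        also have "\<dots> \<le> 1 / norm z ^ Suc (n + 1)"
        proof (rule divide_left_mono)
          have "Suc (n + 1) \<le> 2 * N + 1"
            unfolding N_def by presburger
          then show "norm z ^ Suc (n + 1) \<le> norm z ^ (2 * N + 1)"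
            using z by (intro power_increasing)
        qed (use z in \<open>auto intro!: mult_pos_pos zero_less_power\<close>)
        finally show "norm (z * (1 / z ^ (2 * N + 2))) \<le> 1 * norm (1 / z ^ Suc (n + 1))"
          by (simp add: norm_divide norm_power norm_mult)
      qed
    qed simp
    also note inverse_power_Suc_smallo
    finally show ?thesis .
  qed
  ultimately show "(\<lambda>z. z * stieltjes \<mu> (z\<^sup>2) - (- (\<Sum>j\<le>n. of_real (sqrt_moment j) / z ^ (j + 1))))
      \<in> o[?G](\<lambda>z. 1 / z ^ (n + 1))"
    by (subst landau_o.small.in_cong)
qed

lemma is_jacobi_matrix_of_UL:
  "is_jacobi_matrix_of (gen_upper u \<odot> gen_lower l) (\<lambda>z. z * stieltjes \<mu> (z\<^sup>2))"
  unfolding is_jacobi_matrix_of_def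
  using is_monic_jacobi_UL asymptotic_expansion T_orthogonal by blast

end

theorem theorem5p2:
  fixes \<mu> :: "real measure"
    and P :: "nat \<Rightarrow> real poly"
    and b c u l :: "nat \<Rightarrow> real"
    and \<ZZ> :: "complex \<Rightarrow> complex"
    and \<JJ> \<LL> \<UU> :: smat
  assumes "nontrivial_prob_measure \<mu>"
    and "emeasure \<mu> {..<0} = 0"
    and "monic_orthogonal_polys (measure_functional \<mu>) P"
    and "\<forall>j. c j > 0"
    and "\<forall>j. [:0, 1:] * P j =
           P (Suc j) + Polynomial.smult (b j) (P j) + (if j = 0 then 0 else Polynomial.smult (c (j - 1)) (P (j - 1)))"
  defines "\<ZZ> \<equiv> \<lambda>z. stieltjes \<mu> (z\<^sup>2)"
    and "u \<equiv> darboux_u P"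
    and "l \<equiv> darboux_l P c"
    and "\<JJ> \<equiv> gen_jacobi b c"
    and "\<LL> \<equiv> gen_lower l"
    and "\<UU> \<equiv> gen_upper u"
  shows "\<JJ> = \<LL> \<odot> \<UU> \<and>
    is_first_coeff \<ZZ> 0 \<and>
    (\<forall>s\<^sub>0. is_first_coeff \<ZZ> s\<^sub>0 \<longrightarrow>
       s\<^sub>0 = 0 \<and>
       (\<forall>z. z * \<ZZ> z + of_real s\<^sub>0 = z * stieltjes \<mu> (z\<^sup>2)) \<and>
       is_jacobi_matrix_of (\<UU> \<odot> \<LL>) (\<lambda>z. z * \<ZZ> z + of_real s\<^sub>0)) \<and>
    (\<forall>j z. cpoly (monic_polys (\<UU> \<odot> \<LL>) (2 * j)) z = cpoly (P j) (z\<^sup>2)) \<and>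
    (\<forall>j z. cpoly (monic_polys (\<UU> \<odot> \<LL>) (2 * j + 1)) z
             = z * cpoly (monic_polys (darboux P c) j) (z\<^sup>2)) \<and>
    (\<forall>j z. z \<noteq> 0 \<longrightarrow>
       z * cpoly (monic_polys (darboux P c) j) (z\<^sup>2)
         = 1 / z * (cpoly (P (Suc j)) (z\<^sup>2)
                    - of_real (poly (P (Suc j)) 0 / poly (P j) 0) * cpoly (P j) (z\<^sup>2)))"
proof -
  interpret half_line_jacobi \<mu> P b c
    using assms(1-5) by unfold_locales auto
  have ZZ_0: "is_first_coeff \<ZZ> 0"
    unfolding \<ZZ>_def by (rule first_coeff_stieltjes_square)
  have "gen_lower l \<odot> gen_upper u = gen_jacobi b c"
    by (rule gen_lower_mult_gen_upper) (simp_all add: u_def l_def b_0 b_Suc c_eq)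
  then have LU: "\<JJ> = \<LL> \<odot> \<UU>"
    unfolding \<JJ>_def \<LL>_def \<UU>_def by simp
  have expansion: "s\<^sub>0 = 0 \<and> (\<forall>z. z * \<ZZ> z + of_real s\<^sub>0 = z * stieltjes \<mu> (z\<^sup>2)) \<and>
       is_jacobi_matrix_of (\<UU> \<odot> \<LL>) (\<lambda>z. z * \<ZZ> z + of_real s\<^sub>0)" if "is_first_coeff \<ZZ> s\<^sub>0" for s\<^sub>0
    using is_first_coeff_unique[OF that ZZ_0] is_jacobi_matrix_of_UL
    by (simp add: \<ZZ>_def \<UU>_def \<LL>_def u_def l_def)
  have even: "cpoly (monic_polys (\<UU> \<odot> \<LL>) (2 * j)) z = cpoly (P j) (z\<^sup>2)" for j z
    unfolding \<UU>_def \<LL>_def u_def l_def by (simp add: T_even cpoly_pcompose_sqX)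
  have odd: "cpoly (monic_polys (\<UU> \<odot> \<LL>) (2 * j + 1)) z
      = z * cpoly (monic_polys (darboux P c) j) (z\<^sup>2)" for j z
    unfolding \<UU>_def \<LL>_def u_def l_def Suc_eq_plus1[symmetric] by (simp only: T_odd) (simp add: cpoly_pcompose_sqX)
  have kernel: "z * cpoly (monic_polys (darboux P c) j) (z\<^sup>2)
         = 1 / z * (cpoly (P (Suc j)) (z\<^sup>2)
                    - of_real (poly (P (Suc j)) 0 / poly (P j) 0) * cpoly (P j) (z\<^sup>2))" if "z \<noteq> 0" for j z
  proof -
    \<comment> \<open>The first relation of \<open>R_eqs\<close> taken at z^2: its factor x becomes
      z^2, and dividing by z leaves the single factor z.\<close>
    have "cpoly (pCons 0 (monic_polys (darboux P c) j)) (z\<^sup>2)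
        = cpoly (P (Suc j) + Polynomial.smult (darboux_u P j) (P j)) (z\<^sup>2)"
      by (simp only: pCons_R)
    then have "z\<^sup>2 * cpoly (monic_polys (darboux P c) j) (z\<^sup>2) = cpoly (P (Suc j)) (z\<^sup>2)
        - of_real (poly (P (Suc j)) 0 / poly (P j) 0) * cpoly (P j) (z\<^sup>2)"
      by (simp only: cpoly_add cpoly_smult) (simp add: darboux_u_def)
    from this[symmetric] show ?thesis
      using that by (simp add: power2_eq_square)
  qed
  show ?thesis
    using LU ZZ_0 expansion even odd kernel by blast
qed

end
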